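(* Let $m\ge 1$ and let $\mathcal{X}$ be a Banach space. A function $f:\mathbb{R}^m\to\mathcal{X}$ is compact almost automorphic if and only if it is $\mathbb{Z}^m$-almost automorphic and uniformly continuous; that is, $$\mathcal{K}AA(\mathbb{R}^m;\mathcal{X})=\mathbb{Z}^mAA(\mathbb{R}^m;\mathcal{X})\cap UC(\mathbb{R}^m;\mathcal{X}).$$
   Context: For a non-empty set $\mathcal{G}\subset\mathbb{R}^m$, a continuous function $f:\mathbb{R}^m\to\mathcal{X}$ is called $\mathcal{G}$-(multi-)almost automorphic if for every sequence $(\mathbf{b}_k)$ of elements of $\mathcal{G}$ there exist a subsequence $(\mathbf{b}_{k_l})$ and a function $f^*:\mathbb{R}^m\to\mathcal{X}$ such that, for every $\mathbf{t}\in\mathbb{R}^m$, $\lim_{l\to\infty}f(\mathbf{t}+\mathbf{b}_{k_l})=f^*(\mathbf{t})$ and $\lim_{l\to\infty}f^*(\mathbf{t}-\mathbf{b}_{k_l})=f(\mathbf{t})$. The space of these functions is $\mathcal{G}AA(\mathbb{R}^m;\mathcal{X})$; the case $\mathcal{G}=\mathbb{Z}^m$ gives $\mathbb{Z}^mAA(\mathbb{R}^m;\mathcal{X})$. A continuous function $f:\mathbb{R}^m\to\mathcal{X}$ is compact almost automorphic if for every sequence $(\mathbf{b}_k)$ in $\mathbb{R}^m$ there exist a subsequence $(\mathbf{b}_{k_l})$ and a function $f^*:\mathbb{R}^m\to\mathcal{X}$ such that for every compact $\mathcal{K}\subset\mathbb{R}^m$, $\lim_{l}\sup_{\mathbf{t}\in\mathcal{K}}\|f(\mathbf{t}+\mathbf{b}_{k_l})-f^*(\mathbf{t})\|=0$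 and $\lim_l\sup_{\mathbf{t}\in\mathcal{K}}\|f^*(\mathbf{t}-\mathbf{b}_{k_l})-f(\mathbf{t})\|=0$. The space of these functions is $\mathcal{K}AA(\mathbb{R}^m;\mathcal{X})$. $UC(\mathbb{R}^m;\mathcal{X})$ is the space of uniformly continuous functions $\mathbb{R}^m\to\mathcal{X}$. *)

theory Defs
  imports "HOL-Analysis.Analysis"
begin

definition almost_automorphic_wrt ::
    "(real^'m) set \<Rightarrow> (real^'m \<Rightarrow> 'x::banach) \<Rightarrow> bool" where
  "almost_automorphic_wrt G f \<longleftrightarrow>
     continuous_on UNIV f \<and>
     (\<forall>b :: nat \<Rightarrow> real^'m. range b \<subseteq> G \<longrightarrow>
        (\<exists>r fs. strict_mono (r :: nat \<Rightarrow> nat) \<and>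
           (\<forall>t. (\<lambda>l. f (t + b (r l))) \<longlonglongrightarrow> fs t \<and>
                (\<lambda>l. fs (t - b (r l))) \<longlonglongrightarrow> f t)))"

(* The supremum is taken in ennreal: the limit function is not assumed bounded on K, and in
   type real the supremum of an unbounded set is unspecified.  On K = {} the supremum is 0. *)
definition compact_almost_automorphic :: "(real^'m \<Rightarrow> 'x::banach) \<Rightarrow> bool" where
  "compact_almost_automorphic f \<longleftrightarrow>
     continuous_on UNIV f \<and>
     (\<forall>b :: nat \<Rightarrow> real^'m.
        (\<exists>r fs. strict_mono (r :: nat \<Rightarrow> nat) \<and>
           (\<forall>K. compact K \<longrightarrow>
              (\<lambda>l. SUP t\<in>K. ennreal (norm (f (t + b (r l)) - fs t))) \<longlonglongrightarrow> 0 \<and>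
              (\<lambda>l. SUP t\<in>K. ennreal (norm (fs (t - b (r l)) - f t))) \<longlonglongrightarrow> 0)))"

definition int_lattice :: "(real^'m) set" where
  "int_lattice = {b. \<forall>i. b $ i \<in> \<int>}"

definition AA :: "(real^'m) set \<Rightarrow> (real^'m \<Rightarrow> 'x::banach) set" where
  "AA G = {f. almost_automorphic_wrt G f}"

definition KAA :: "(real^'m \<Rightarrow> 'x::banach) set" where
  "KAA = {f. compact_almost_automorphic f}"

definition UC :: "(real^'m \<Rightarrow> 'x::banach) set" where
  "UC = {f. uniformly_continuous_on UNIV f}"

lemma SUP_norm_tendsto_0_iff_uniform_limit:
  fixes g :: "nat \<Rightarrow> 'a \<Rightarrow> 'x::real_normed_vector"
  shows "(\<lambda>l. SUP t\<in>K. ennreal (norm (g l t - h t))) \<longlonglongrightarrow> 0 \<longleftrightarrow>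
         uniform_limit K g h sequentially"
proof
  assume L: "(\<lambda>l. SUP t\<in>K. ennreal (norm (g l t - h t))) \<longlonglongrightarrow> 0"
  show "uniform_limit K g h sequentially"
  proof (rule uniform_limitI)
    fix e :: real assume "e > 0"
    then have "\<forall>\<^sub>F l in sequentially. (SUP t\<in>K. ennreal (norm (g l t - h t))) < ennreal e"
      using order_tendstoD(2)[OF L, of "ennreal e"] by simp
    then show "\<forall>\<^sub>F l in sequentially. \<forall>t\<in>K. dist (g l t) (h t) < e"
    proof eventually_elim
      case (elim l)
      show ?case
      proof
        fix t assume "t \<in> K"
        then have "ennreal (norm (g l t - h t)) < ennreal e"
          using elim by (meson SUP_upper le_less_trans)
        then show "dist (g l t) (h t) < e"
          using \<open>e > 0\<close> by (simp add: dist_norm ennreal_less_iff)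
      qed
    qed
  qed
next
  assume U: "uniform_limit K g h sequentially"
  show "(\<lambda>l. SUP t\<in>K. ennreal (norm (g l t - h t))) \<longlonglongrightarrow> 0"
  proof (rule order_tendstoI)
    fix a :: ennreal assume "0 < a"
    then obtain c where c: "0 < c" "c < a"
      using dense by blast
    then obtain e where e: "c = ennreal e" "e > 0"
      by (cases c) auto
    from uniform_limitD[OF U e(2)]
    show "\<forall>\<^sub>F l in sequentially. (SUP t\<in>K. ennreal (norm (g l t - h t))) < a"
    proof eventually_elim
      case (elim l)
      have "(SUP t\<in>K. ennreal (norm (g l t - h t))) \<le> c"
        unfolding e(1) using elim
        by (intro SUP_least ennreal_leI) (auto simp: dist_norm less_imp_le)
      then show ?case using c(2) by simp
    qed
  qed simp
qed

end

theory Submission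
  imports Defs
begin

text \<open>
  Uniform convergence on singletons is pointwise convergence, so a compact almost automorphic function
  is almost automorphic along any set of translations. The content is that it is also uniformly
  continuous and that, conversely, uniform continuity lets integer translations control all
  translations.

  If \<open>f\<close> is compact almost automorphic but points \<open>x k\<close>, \<open>y k\<close> with \<open>x k - y k\<close> tending to \<open>0\<close> have
  values a fixed distance apart, one translates along \<open>x k\<close>: a subsequence of \<open>f (t + x k)\<close> converges
  uniformly on the unit ball, hence to a continuous limit, and so both \<open>f (x k)\<close> and
  \<open>f (y k) = f ((y k - x k) + x k)\<close> approach the value of the limit at \<open>0\<close>.

  Conversely, a sequence \<open>b k\<close> splits into the integer vectors \<open>n k\<close> of its coordinatewise floors and
  remainders \<open>s k\<close> in the unit cube. Along a subsequence \<open>s k\<close> converges to some \<open>s\<close>, and \<open>n k\<close>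
  realises the almost automorphy of \<open>f\<close> with some limit \<open>h\<close>. The translates of a uniformly continuous
  function share one modulus of continuity, and this modulus passes to \<open>h\<close>; pointwise convergence of
  such families is automatically uniform on compact sets (\<open>uniform_limit_if_equicontinuous\<close>), and the
  vanishing errors \<open>s k - s\<close> do not affect it (\<open>uniform_limit_perturbed_translates\<close>). Hence
  \<open>t \<mapsto> h (t + s)\<close> is the limit function required for \<open>b\<close>.
\<close>

definition uniformly_equicontinuous ::
    "('i \<Rightarrow> 'a::metric_space \<Rightarrow> 'b::metric_space) \<Rightarrow> bool" where
  "uniformly_equicontinuous g \<longleftrightarrow>
     (\<forall>e>0. \<exists>d>0. \<forall>i x y. dist x y < d \<longrightarrow> dist (g i x) (g i y) < e)"

lemma uniformly_equicontinuous_translates: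
  fixes f :: "'a::real_normed_vector \<Rightarrow> 'b::metric_space"
  assumes "uniformly_continuous_on UNIV f"
  shows "uniformly_equicontinuous (\<lambda>i t. f (t + c i))"
  using assms unfolding uniformly_equicontinuous_def uniformly_continuous_on_def
  by (metis UNIV_I dist_add_cancel2 dist_commute)

lemma uniformly_continuous_on_equicontinuous_limit:
  fixes g :: "nat \<Rightarrow> 'a::metric_space \<Rightarrow> 'b::metric_space"
  assumes eq: "uniformly_equicontinuous g" and lim: "\<And>t. (\<lambda>l. g l t) \<longlonglongrightarrow> h t"
  shows "uniformly_continuous_on UNIV h"
  unfolding uniformly_continuous_on_def
proof (intro allI impI)
  fix e :: real assume "e > 0"
  then obtain d where d: "d > 0" "\<And>l x y. dist x y < d \<Longrightarrow> dist (g l x) (g l y) < e / 2"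
    using eq unfolding uniformly_equicontinuous_def by (meson half_gt_zero)
  have "dist (h y) (h x) < e" if "dist y x < d" for x y
  proof -
    have "dist (h y) (h x) \<le> e / 2"
    proof (rule tendsto_upperbound)
      show "(\<lambda>l. dist (g l y) (g l x)) \<longlonglongrightarrow> dist (h y) (h x)"
        by (intro tendsto_dist lim)
      show "\<forall>\<^sub>F l in sequentially. dist (g l y) (g l x) \<le> e / 2"
        using d(2)[OF that] by (simp add: less_imp_le)
    qed simp
    then show ?thesis using \<open>e > 0\<close> by simp
  qed
  then show "\<exists>d>0. \<forall>x\<in>UNIV. \<forall>x'\<in>UNIV. dist x' x < d \<longrightarrow> dist (h x') (h x) < e"
    using d(1) by blast
qed

text \<open>
  The limit has a modulus of continuity as well, so a finite net of the compact set reduces uniform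
  convergence to convergence at finitely many points.
\<close>

lemma uniform_limit_if_equicontinuous:
  fixes g :: "nat \<Rightarrow> 'a::metric_space \<Rightarrow> 'b::metric_space"
  assumes eq: "uniformly_equicontinuous g" and lim: "\<And>t. (\<lambda>l. g l t) \<longlonglongrightarrow> h t"
    and "compact K"
  shows "uniform_limit K g h sequentially"
proof (rule uniform_limitI)
  fix e :: real assume "e > 0"
  then have e3: "e / 3 > 0" by simp
  obtain d1 where d1: "d1 > 0" "\<And>l x y. dist x y < d1 \<Longrightarrow> dist (g l x) (g l y) < e / 3"
    using eq e3 unfolding uniformly_equicontinuous_def by meson
  obtain d2 where d2: "d2 > 0" "\<And>x y. dist x y < d2 \<Longrightarrow> dist (h x) (h y) < e / 3"
    using uniformly_continuous_on_equicontinuous_limit[OF eq lim] e3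
    unfolding uniformly_continuous_on_def by (metis UNIV_I)
  define d where "d = min d1 d2"
  have "d > 0" using d1 d2 by (simp add: d_def)
  obtain N where N: "finite N" "K \<subseteq> (\<Union>x\<in>N. ball x d)"
    using \<open>compact K\<close> \<open>d > 0\<close> by (metis compact_eq_totally_bounded)
  have "\<forall>\<^sub>F l in sequentially. \<forall>x\<in>N. dist (g l x) (h x) < e / 3"
    using N(1) by (intro eventually_ball_finite ballI tendstoD[OF lim e3])
  then show "\<forall>\<^sub>F l in sequentially. \<forall>t\<in>K. dist (g l t) (h t) < e"
  proof eventually_elim
    case (elim l)
    show ?case
    proof
      fix t assume "t \<in> K"
      then obtain x where x: "x \<in> N" "dist x t < d" using N(2) by auto
      then have "dist (g l x) (g l t) < e / 3" "dist (g l x) (h x) < e / 3"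
        "dist (h x) (h t) < e / 3"
        using d1(2) d2(2) elim by (auto simp: d_def)
      then show "dist (g l t) (h t) < e"
        by metric
    qed
  qed
qed

text \<open>
  A perturbation of the translation vectors moves the value of a uniformly continuous function by an
  amount bounded uniformly in the point \<open>t\<close>.
\<close>

lemma uniform_limit_perturbed_translates:
  fixes f :: "'a::real_normed_vector \<Rightarrow> 'b::metric_space"
  assumes uc: "uniformly_continuous_on UNIV f"
    and lim: "uniform_limit K (\<lambda>l t. f (t + c l)) h sequentially"
    and "\<delta> \<longlonglongrightarrow> 0"
  shows "uniform_limit K (\<lambda>l t. f (t + c l + \<delta> l)) h sequentially"
proof (rule uniform_limitI)
  fix e :: real assume "e > 0"
  then have e2: "e / 2 > 0" by simp
  obtain d where d: "d > 0" "\<And>x y. dist x y < d \<Longrightarrow> dist (f x) (f y) < e / 2"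
    using uc e2 unfolding uniformly_continuous_on_def by (metis UNIV_I)
  show "\<forall>\<^sub>F l in sequentially. \<forall>t\<in>K. dist (f (t + c l + \<delta> l)) (h t) < e"
    using uniform_limitD[OF lim e2] tendstoD[OF \<open>\<delta> \<longlonglongrightarrow> 0\<close> d(1)]
  proof eventually_elim
    case (elim l)
    show ?case
    proof
      fix t assume "t \<in> K"
      have "dist (f (t + c l + \<delta> l)) (f (t + c l)) < e / 2"
        using elim(2) by (intro d(2)) (simp add: dist_norm)
      moreover have "dist (f (t + c l)) (h t) < e / 2"
        using elim(1) \<open>t \<in> K\<close> by simp
      ultimately show "dist (f (t + c l + \<delta> l)) (h t) < e"
        by metric
    qed
  qed
qed

lemma compact_almost_automorphic_iff_uniform_limit:
  "compact_almost_automorphic f \<longleftrightarrow>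
     continuous_on UNIV f \<and>
     (\<forall>b. \<exists>r fs. strict_mono (r :: nat \<Rightarrow> nat) \<and>
        (\<forall>K. compact K \<longrightarrow>
           uniform_limit K (\<lambda>l t. f (t + b (r l))) fs sequentially \<and>
           uniform_limit K (\<lambda>l t. fs (t - b (r l))) f sequentially))"
  unfolding compact_almost_automorphic_def SUP_norm_tendsto_0_iff_uniform_limit ..

lemma compact_almost_automorphic_imp_almost_automorphic_wrt:
  assumes "compact_almost_automorphic f"
  shows "almost_automorphic_wrt G f"
  unfolding almost_automorphic_wrt_def
proof (intro conjI allI impI)
  show "continuous_on UNIV f"
    using assms by (simp add: compact_almost_automorphic_iff_uniform_limit)
  fix b :: "nat \<Rightarrow> real^'a"
  obtain r fs where r: "strict_mono (r :: nat \<Rightarrow> nat)"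
    and K: "\<And>K. compact K \<Longrightarrow> uniform_limit K (\<lambda>l t. f (t + b (r l))) fs sequentially"
      "\<And>K. compact K \<Longrightarrow> uniform_limit K (\<lambda>l t. fs (t - b (r l))) f sequentially"
    using assms unfolding compact_almost_automorphic_iff_uniform_limit by meson
  show "\<exists>r fs. strict_mono (r :: nat \<Rightarrow> nat) \<and>
      (\<forall>t. (\<lambda>l. f (t + b (r l))) \<longlonglongrightarrow> fs t \<and> (\<lambda>l. fs (t - b (r l))) \<longlonglongrightarrow> f t)"
  proof (intro exI conjI allI)
    show "strict_mono r" by (fact r)
    show "(\<lambda>l. f (t + b (r l))) \<longlonglongrightarrow> fs t" for t
      using tendsto_uniform_limitI[OF K(1)[of "{t}"], of t] by simp
    show "(\<lambda>l. fs (t - b (r l))) \<longlonglongrightarrow> f t" for t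
      using tendsto_uniform_limitI[OF K(2)[of "{t}"], of t] by simp
  qed
qed

text \<open>
  Translating along a sequence that violates uniform continuity brings the offending pairs of points
  to \<open>0\<close>, where uniform convergence on the unit ball and continuity of the limit exclude them.
\<close>

lemma compact_almost_automorphic_imp_uniformly_continuous:
  assumes "compact_almost_automorphic f"
  shows "uniformly_continuous_on UNIV f"
proof (rule ccontr)
  assume "\<not> uniformly_continuous_on UNIV f"
  then obtain e where "e > 0" and "\<forall>d>0. \<exists>x y. dist y x < d \<and> \<not> dist (f y) (f x) < e"
    unfolding uniformly_continuous_on_def by auto
  then have "\<exists>x y. dist y x < inverse (Suc k) \<and> \<not> dist (f y) (f x) < e" for k
    by simp
  then obtain x y where xy: "\<And>k. dist (y k) (x k) < inverse (Suc k)"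
    "\<And>k. \<not> dist (f (y k)) (f (x k)) < e"
    by metis
  have cont: "continuous_on UNIV f"
    using assms by (simp add: compact_almost_automorphic_iff_uniform_limit)
  obtain r fs where r: "strict_mono (r :: nat \<Rightarrow> nat)"
    and lim: "uniform_limit (cball 0 1) (\<lambda>l t. f (t + x (r l))) fs sequentially"
    using assms compact_cball unfolding compact_almost_automorphic_iff_uniform_limit by meson
  define z where "z l = y (r l) - x (r l)" for l
  have z_bound: "norm (z l) < inverse (Suc l)" for l
  proof -
    have "norm (z l) < inverse (Suc (r l))"
      using xy(1)[of "r l"] by (simp add: z_def dist_norm)
    also have "\<dots> \<le> inverse (Suc l)"
      using seq_suble[OF r, of l] by (intro le_imp_inverse_le) auto
    finally show ?thesis .
  qed
  have z0: "z \<longlonglongrightarrow> 0"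
    by (rule Lim_null_comparison[OF _ LIMSEQ_inverse_real_of_nat])
      (intro always_eventually allI less_imp_le z_bound)
  have z_ball: "z l \<in> cball 0 1" for l
  proof -
    have "inverse (real (Suc l)) \<le> 1" by (simp add: inverse_le_1_iff)
    then show ?thesis using z_bound[of l] by (simp only: mem_cball_0)
  qed
  have fs_cont: "continuous_on (cball 0 1) fs"
  proof (rule uniform_limit_theorem[OF _ lim])
    show "\<forall>\<^sub>F l in sequentially. continuous_on (cball 0 1) (\<lambda>t. f (t + x (r l)))"
      by (intro always_eventually allI continuous_on_compose2[OF cont] continuous_intros) auto
  qed simp
  \<comment> \<open>The evaluation points \<open>z l\<close> move with \<open>l\<close>; uniform convergence is what allows replacing
    \<open>f (z l + x (r l))\<close> by \<open>fs (z l)\<close>.\<close>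
  have y_lim: "(\<lambda>l. f (y (r l))) \<longlonglongrightarrow> fs 0"
  proof -
    have "(\<lambda>l. fs (z l)) \<longlonglongrightarrow> fs 0"
      using continuous_on_tendsto_compose[OF fs_cont z0] z_ball by simp
    moreover have "(\<lambda>l. f (y (r l)) - fs (z l)) \<longlonglongrightarrow> 0"
    proof (rule tendstoI)
      fix \<epsilon> :: real assume "\<epsilon> > 0"
      show "\<forall>\<^sub>F l in sequentially. dist (f (y (r l)) - fs (z l)) 0 < \<epsilon>"
        using uniform_limitD[OF lim \<open>\<epsilon> > 0\<close>]
      proof eventually_elim
        case (elim l)
        then have "dist (f (z l + x (r l))) (fs (z l)) < \<epsilon>"
          using z_ball by blast
        then show ?case by (simp add: z_def dist_norm)
      qed
    qed
    ultimately show ?thesis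
      by (rule Lim_transform)
  qed
  have x_lim: "(\<lambda>l. f (x (r l))) \<longlonglongrightarrow> fs 0"
    using tendsto_uniform_limitI[OF lim, of 0] by simp
  have "(\<lambda>l. dist (f (y (r l))) (f (x (r l)))) \<longlonglongrightarrow> 0"
    using tendsto_dist[OF y_lim x_lim] by simp
  then have "\<forall>\<^sub>F l in sequentially. dist (f (y (r l))) (f (x (r l))) < e"
    using \<open>e > 0\<close> by (rule order_tendstoD)
  then show False
    using xy(2) by simp
qed

text \<open>
  The second limit, in which \<open>h\<close> itself is translated, is as uniform as the first because \<open>h\<close>
  inherits uniform continuity from \<open>f\<close>.
\<close>

lemma lattice_almost_automorphic_imp_compact_almost_automorphic:
  fixes f :: "real^'m \<Rightarrow> 'x::banach"
  assumes aa: "almost_automorphic_wrt int_lattice f" and uc: "uniformly_continuous_on UNIV f"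
  shows "compact_almost_automorphic f"
  unfolding compact_almost_automorphic_iff_uniform_limit
proof (intro conjI allI)
  show "continuous_on UNIV f"
    using aa by (simp add: almost_automorphic_wrt_def)
  fix b :: "nat \<Rightarrow> real^'m"
  define n :: "nat \<Rightarrow> real^'m" where "n k = (\<chi> i. of_int \<lfloor>b k $ i\<rfloor>)" for k
  have n_lattice: "range n \<subseteq> int_lattice"
    by (auto simp: n_def int_lattice_def)
  obtain r1 h where r1: "strict_mono (r1 :: nat \<Rightarrow> nat)"
    and h: "\<And>t. (\<lambda>l. f (t + n (r1 l))) \<longlonglongrightarrow> h t" "\<And>t. (\<lambda>l. h (t - n (r1 l))) \<longlonglongrightarrow> f t"
    using aa n_lattice unfolding almost_automorphic_wrt_def by meson
  \<comment> \<open>The remainders lie in the unit cube, so they converge along a further subsequence.\<close>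
  have cube: "b k - n k \<in> cbox 0 1" for k
    by (auto simp: mem_box_cart n_def) linarith
  obtain s r2 where r2: "strict_mono (r2 :: nat \<Rightarrow> nat)"
    and s: "(\<lambda>l. b (r1 (r2 l)) - n (r1 (r2 l))) \<longlonglongrightarrow> s"
  proof -
    have "seq_compact (cbox 0 (1 :: real^'m))"
      by (intro compact_imp_seq_compact compact_cbox)
    then show ?thesis
      using that cube
      by (elim seq_compactE[where f = "\<lambda>l. b (r1 l) - n (r1 l)"]) (auto simp: comp_def)
  qed
  define r where "r = r1 \<circ> r2"
  have r: "strict_mono r"
    using r1 r2 by (simp add: r_def strict_mono_o)
  have h_r: "(\<lambda>l. f (t + n (r l))) \<longlonglongrightarrow> h t" "(\<lambda>l. h (t - n (r l))) \<longlonglongrightarrow> f t" for t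
    using LIMSEQ_subseq_LIMSEQ[OF h(1) r2] LIMSEQ_subseq_LIMSEQ[OF h(2) r2]
    by (simp_all add: r_def comp_def)
  have h_uc: "uniformly_continuous_on UNIV h"
    by (rule uniformly_continuous_on_equicontinuous_limit
          [OF uniformly_equicontinuous_translates[OF uc] h_r(1)])
  have rem: "(\<lambda>l. b (r l) - n (r l) - s) \<longlonglongrightarrow> 0" "(\<lambda>l. s - (b (r l) - n (r l))) \<longlonglongrightarrow> 0"
    using tendsto_diff[OF s tendsto_const[of s]] tendsto_diff[OF tendsto_const[of s] s]
    by (simp_all add: r_def)
  show "\<exists>r fs. strict_mono (r :: nat \<Rightarrow> nat) \<and>
      (\<forall>K. compact K \<longrightarrow>
         uniform_limit K (\<lambda>l t. f (t + b (r l))) fs sequentially \<and>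
         uniform_limit K (\<lambda>l t. fs (t - b (r l))) f sequentially)"
  proof (intro exI conjI allI impI)
    show "strict_mono r" by (fact r)
    fix K :: "(real^'m) set" assume "compact K"
    have "uniform_limit K (\<lambda>l t. f (t + (s + n (r l)))) (\<lambda>t. h (t + s)) sequentially"
      using uniformly_equicontinuous_translates[OF uc] h_r(1)[of "t + s" for t] \<open>compact K\<close>
      by (intro uniform_limit_if_equicontinuous) (simp_all add: add.assoc)
    from uniform_limit_perturbed_translates[OF uc this rem(1)]
    show "uniform_limit K (\<lambda>l t. f (t + b (r l))) (\<lambda>t. h (t + s)) sequentially"
      by (simp add: algebra_simps)
    have "uniform_limit K (\<lambda>l t. h (t + - n (r l))) f sequentially"
      using uniformly_equicontinuous_translates[OF h_uc, of "\<lambda>l. - n (r l)"] h_r(2) \<open>compact K\<close>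
      by (intro uniform_limit_if_equicontinuous) simp_all
    from uniform_limit_perturbed_translates[OF h_uc this rem(2)]
    show "uniform_limit K (\<lambda>l t. h (t - b (r l) + s)) f sequentially"
      by (simp add: algebra_simps)
  qed
qed

theorem theorem4p2:
  shows "(KAA :: (real^'m \<Rightarrow> 'x::banach) set) = AA int_lattice \<inter> UC"
  unfolding KAA_def AA_def UC_def
  using compact_almost_automorphic_imp_almost_automorphic_wrt
    compact_almost_automorphic_imp_uniformly_continuous
    lattice_almost_automorphic_imp_compact_almost_automorphic
  by blast

end
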